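(* Let $K\ge 2$, $n\ge1$, $\tau\in(0,1]$, let $\tilde g_1,\dots,\tilde g_K\in\mathbb{R}^n$, and suppose $F_\tau\neq\emptyset$. Then $$\tilde d^*=0\quad\Longleftrightarrow\quad \tilde g_i=0\ \text{ for all } i\in\{1,\dots,K\}.$$
   Context: $\|\cdot\|$ is the Euclidean norm. The vectors $\tilde g_1$ (primary) and $\tilde g_2,\dots,\tilde g_K$ (secondary) are the normalized (sub)gradients at a fixed parameter point $\theta$; here they are treated as given vectors in $\mathbb{R}^n$. The feasible set is $F_\tau=\bigcap_{j=2}^K\{d\in\mathbb{R}^n:\tilde g_j^\top d\ge\tau\|\tilde g_j\|^2\}$. The PCD direction is the solution of the quadratic program $\tilde d^*=\arg\min_{d\in F_\tau}\|d-\tilde g_1\|^2$. *)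

theory Defs
  imports "HOL-Analysis.Analysis"
begin

definition feasible_set :: "real \<Rightarrow> nat \<Rightarrow> (nat \<Rightarrow> real ^ 'n) \<Rightarrow> (real ^ 'n) set" where
  "feasible_set \<tau> K g = (\<Inter>j\<in>{2..K}. {d. g j \<bullet> d \<ge> \<tau> * (norm (g j))\<^sup>2})"

text \<open>
  The library's \<open>arg_min_on\<close> is a choice operator, unspecified when there is no minimizer.
  For a nonempty feasible set it denotes the unique minimizer, see
  \<open>pcd_direction_unique\<close>.
\<close>

definition pcd_direction :: "real \<Rightarrow> nat \<Rightarrow> (nat \<Rightarrow> real ^ 'n) \<Rightarrow> real ^ 'n" where
  "pcd_direction \<tau> K g = arg_min_on (\<lambda>d. (norm (d - g 1))\<^sup>2) (feasible_set \<tau> K g)"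

lemma closed_feasible_set: "closed (feasible_set \<tau> K g)"
  unfolding feasible_set_def by (intro closed_INT ballI closed_halfspace_ge)

lemma convex_feasible_set: "convex (feasible_set \<tau> K g)"
  unfolding feasible_set_def by (intro convex_INT convex_halfspace_ge)

lemma pcd_direction_unique:
  fixes g :: "nat \<Rightarrow> real ^ 'n"
  assumes "feasible_set \<tau> K g \<noteq> {}"
  shows "is_arg_min (\<lambda>d. (norm (d - g 1))\<^sup>2) (\<lambda>d. d \<in> feasible_set \<tau> K g) d
    \<longleftrightarrow> d = pcd_direction \<tau> K g"
proof -
  let ?F = "feasible_set \<tau> K g"
  let ?M = "is_arg_min (\<lambda>d. (norm (d - g 1))\<^sup>2) (\<lambda>d. d \<in> ?F)"
  have M: "?M x \<longleftrightarrow> x \<in> ?F \<and> (\<forall>y\<in>?F. dist (g 1) x \<le> dist (g 1) y)" for x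
    by (auto simp: is_arg_min_def dist_norm norm_minus_commute not_less
        abs_le_square_iff[symmetric])
  have ex: "?M (closest_point ?F (g 1))"
    unfolding M using closest_point_exists[OF closed_feasible_set assms] by blast
  have uniq: "x = y" if "?M x" "?M y" for x y
    using that any_closest_point_unique[OF convex_feasible_set closed_feasible_set]
    unfolding M by blast
  have "?M (pcd_direction \<tau> K g)"
    unfolding pcd_direction_def arg_min_on_def arg_min_def using ex by (rule someI)
  then show ?thesis using uniq by blast
qed

end

theory Submission
  imports Defs
begin

text \<open>At \<open>d = 0\<close> the constraint for \<open>j\<close> reads
  \<open>0 \<ge> \<tau> * (norm (g j))\<^sup>2\<close>, and since \<tau> is positive this forces
  \<open>g j = 0\<close>. So a zero direction, being feasible, kills every secondary gradient
  (\<open>zero_in_feasible_set_iff\<close>). Once these vanish, all constraints are trivial and the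
  projection of \<open>g 1\<close> onto the whole space is \<open>g 1\<close> itself
  (\<open>pcd_direction_unconstrained\<close>), so the direction is zero exactly when
  \<open>g 1\<close> is.\<close>

lemma zero_in_feasible_set_iff:
  assumes "0 < \<tau>"
  shows "0 \<in> feasible_set \<tau> K g \<longleftrightarrow> (\<forall>j\<in>{2..K}. g j = 0)"
  using assms by (auto simp: feasible_set_def mult_le_0_iff)

lemma feasible_set_eq_UNIV:
  assumes "\<forall>j\<in>{2..K}. g j = 0"
  shows "feasible_set \<tau> K g = UNIV"
  using assms by (auto simp: feasible_set_def)

lemma pcd_direction_in_feasible_set:
  assumes "feasible_set \<tau> K g \<noteq> {}"
  shows "pcd_direction \<tau> K g \<in> feasible_set \<tau> K g"
  using pcd_direction_unique[OF assms] by (auto simp: is_arg_min_def)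

text \<open>The objective is nonnegative and vanishes at \<open>g 1\<close>, which is now feasible;
  uniqueness of the minimizer identifies it with the chosen one.\<close>

lemma pcd_direction_unconstrained:
  assumes "feasible_set \<tau> K g = UNIV"
  shows "pcd_direction \<tau> K g = g 1"
proof -
  have "is_arg_min (\<lambda>d. (norm (d - g 1))\<^sup>2) (\<lambda>d. d \<in> feasible_set \<tau> K g) (g 1)"
    using assms by (simp add: is_arg_min_def)
  then show ?thesis
    using pcd_direction_unique[of \<tau> K g "g 1"] assms by simp
qed

theorem theorem4p8:
  fixes K :: nat and \<tau> :: real and g :: "nat \<Rightarrow> real ^ 'n"
  assumes "K \<ge> 2"
    and "0 < \<tau>" and "\<tau> \<le> 1"
    and "feasible_set \<tau> K g \<noteq> {}"
  shows "pcd_direction \<tau> K g = 0 \<longleftrightarrow> (\<forall>i\<in>{1..K}. g i = 0)"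
proof
  assume zero: "pcd_direction \<tau> K g = 0"
  then have secondary: "\<forall>j\<in>{2..K}. g j = 0"
    using pcd_direction_in_feasible_set[OF assms(4)] zero_in_feasible_set_iff[OF assms(2)]
    by metis
  \<comment> \<open>With the constraints gone, the direction equals \<open>g 1\<close>, and it is
    zero by assumption.\<close>
  then have "g 1 = 0"
    using zero pcd_direction_unconstrained[OF feasible_set_eq_UNIV] by metis
  show "\<forall>i\<in>{1..K}. g i = 0"
  proof
    fix i assume "i \<in> {1..K}"
    then have "i = 1 \<or> i \<in> {2..K}" by auto
    then show "g i = 0" using \<open>g 1 = 0\<close> secondary by auto
  qed
next
  assume all: "\<forall>i\<in>{1..K}. g i = 0"
  then have "pcd_direction \<tau> K g = g 1"
    by (intro pcd_direction_unconstrained feasible_set_eq_UNIV) auto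
  then show "pcd_direction \<tau> K g = 0"
    \<comment> \<open>\<open>K \<ge> 2\<close> ensures that the index 1 lies in
      \<open>{1..K}\<close>.\<close>
    using all assms(1) by simp
qed

end
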